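(* Fix $\alpha\in(0,1)$. Assume that the residuals $\widehat{s}_t=y_t-\widehat{\mu}(x_t)$, for $t\in\mathcal{D}_{\mathrm{calib}}\cup\{T+1\}$, are i.i.d., and that the residuals $\widehat{s}_t$, for $t\in\mathcal{D}_{\mathrm{calib}}$, follow some elliptical distribution over $\mathbb{R}^m$ and have a finite second-order moment, with positive definite covariance matrix $\Sigma$. Let $\widetilde{C}^\star_1(x_{T+1}),\ldots,\widetilde{C}^\star_m(x_{T+1})$ be the prediction intervals output by the hierarchical component-wise split conformal procedure (see context) run with the matrix $$P_{\Sigma^{-1}}:=H\bigl(H^\top\Sigma^{-1}H\bigr)^{-1}H^\top\Sigma^{-1}.$$ Let $P$ be any projection matrix onto $\mathrm{Im}(H)$ and let $\widetilde{C}_1(x_{T+1}),\ldots,\widetilde{C}_m(x_{T+1})$ be the prediction intervals output by the same procedure run with $P$. Then $$\forall i\in\{1,\ldots,m\},\qquad \mathbb{E}\Bigl[\mathfrak{L}_1\bigl(\widetilde{C}^\star_i(x_{T+1})\bigr)^2\Bigr]\ \leq\ \mathbb{E}\Bigl[\mathfrak{L}_1\bigl(\widetilde{C}_i(x_{T+1})\bigr)^2\Bigr].$$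
   Context: Hierarchical data: let $m\geq 3$, $2\leq n<m$, $d\geq 1$, and let $H=\begin{bmatrix}\mathrm{Id}_n\\ H_{\mathrm{sub}}\end{bmatrix}$ be a fixed $m\times n$ real matrix, where $H_{\mathrm{sub}}$ is any $(m-n)\times n$ real matrix. The data are random pairs $(x_t,y_t)$, $1\leq t\leq T+1$, with $x_t\in\mathbb{R}^d$ and $y_t\in\mathbb{R}^m$, where all observations are coherent: $y_t=H\,(y_{t,1},\ldots,y_{t,n})^\top$, i.e., $y_t\in\mathrm{Im}(H)$. Expectations are with respect to all the data and may be infinite. $\mathfrak{L}_1$ denotes the Lebesgue measure on $\mathbb{R}$ (an unbounded interval has measure $+\infty$). A projection matrix onto $\mathrm{Im}(H)$ is a (deterministic) $m\times m$ real matrix $P$ with $P^2=P$ and image $\mathrm{Im}(H)$, not necessarily orthogonal. Elliptical distributions: a random vector $z$ follows a spherical distribution over $\mathbb{R}^k$ if $z$ and $\Gamma z$ have the same distribution for all $k\times k$ orthogonal matrices $\Gamma$. An elliptical distribution over $\mathbb{R}^m$ is the distribution of a vector $c+Mz$, for a deterministic $c\in\mathbb{R}^m$, an $m\times k$ matrix $M$ such that $MM^\top$ has rank $k$, and a random vector $z$ following a spherical distribution over $\mathbb{R}^k$. Procedure run with a fixed $m\times m$ matrix $P$: the set of indices $\mathcal{D}_{\mathrm{train}}\cup\mathcal{D}_{\mathrm{calib}}=\{1,\ldots,T\}$ is a (deterministic) partition; let $T_{\mathrm{calib}}$ be the cardinality of $\mathcal{D}_{\mathrm{calib}}$. (1)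 A regression algorithm $\mathcal{A}$ (an arbitrary black box) outputs a function $\widehat{\mu}:\mathbb{R}^d\to\mathbb{R}^m$ based on $(x_t,y_t)_{t\in\mathcal{D}_{\mathrm{train}}}$. Set $\widetilde{\mu}(\cdot)=P\widehat{\mu}(\cdot)$, with components $\widetilde{\mu}_i$. (2) For $t\in\mathcal{D}_{\mathrm{calib}}$, let $\widetilde{s}_t=y_t-\widetilde{\mu}(x_t)$, with components $\widetilde{s}_{t,i}$. (3) For each $i\in\{1,\ldots,m\}$, order $(\widetilde{s}_{t,i})_{t\in\mathcal{D}_{\mathrm{calib}}}$ into $\widetilde{s}_{(1),i}\leq\cdots\leq\widetilde{s}_{(T_{\mathrm{calib}}),i}$ and set $\widetilde{s}_{(0),i}=-\infty$, $\widetilde{s}_{(T_{\mathrm{calib}}+1),i}=+\infty$. (4) Output the prediction intervals $$\widetilde{C}_i(x_{T+1})=\Bigl[\widetilde{\mu}_i(x_{T+1})+\widetilde{s}_{(\lfloor (T_{\mathrm{calib}}+1)\alpha/2\rfloor),i}\,,\ \widetilde{\mu}_i(x_{T+1})+\widetilde{s}_{(\lceil (T_{\mathrm{calib}}+1)(1-\alpha/2)\rceil),i}\Bigr].$$ The two runs compared use the same $\alpha$, the same partition and the same algorithm $\mathcal{A}$ (hence the same $\widehat{\mu}$). *)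

theory Defs
  imports "HOL-Probability.Probability"
begin

text \<open>
  Vectors of the hierarchy are indexed by the sum type \<open>'n + 'p\<close>: \<open>Inl\<close> marks the \<open>n\<close> leading
  components and \<open>Inr\<close> the \<open>m - n\<close> remaining ones, so that \<open>m = CARD('n) + CARD('p)\<close> and
  \<open>n < m\<close> holds automatically.
\<close>

definition hierarchy_matrix :: "real^'n^'p \<Rightarrow> real^'n^('n::finite + 'p::finite)" where
  "hierarchy_matrix Hsub =
     (\<chi> i. case i of Inl a \<Rightarrow> (mat 1 :: real^'n^'n) $ a | Inr b \<Rightarrow> Hsub $ b)"

definition coherent :: "real^'n^('n::finite + 'p::finite) \<Rightarrow> real^('n + 'p) \<Rightarrow> bool" where
  "coherent H y \<longleftrightarrow> y = H *v (\<chi> j. y $ Inl j)"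

definition projection_onto_image :: "real^'n^'m \<Rightarrow> real^'m^'m \<Rightarrow> bool" where
  "projection_onto_image H P \<longleftrightarrow> P ** P = P \<and> range (\<lambda>v. P *v v) = range (\<lambda>v. H *v v)"

definition weighted_projection :: "real^'n^'m \<Rightarrow> real^'m^'m \<Rightarrow> real^'m^'m" where
  "weighted_projection H W =
     H ** matrix_inv (transpose H ** W ** H) ** transpose H ** W"

definition positive_definite :: "real^'m^'m \<Rightarrow> bool" where
  "positive_definite A \<longleftrightarrow> transpose A = A \<and> (\<forall>v. v \<noteq> 0 \<longrightarrow> v \<bullet> (A *v v) > 0)"

definition covariance_matrix :: "'w measure \<Rightarrow> ('w \<Rightarrow> real^'m) \<Rightarrow> real^'m^'m" where
  "covariance_matrix M S =
     (\<chi> i j. (LINT w|M. (S w $ i - (LINT v|M. S v $ i)) * (S w $ j - (LINT v|M. S v $ j))))"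

text \<open>
  The dimension \<open>k\<close> of the spherical vector is existentially quantified in the definition of an
  elliptical distribution, hence cannot be a type: \<open>\<real>\<^sup>k\<close> is the space of extensional functions
  on \<open>{..<k}\<close> with the product Borel sigma-algebra, and matrices with \<open>k\<close> columns are functions
  of which only the entries with column index below \<open>k\<close> matter.
\<close>

abbreviation euclidean_borel :: "nat \<Rightarrow> (nat \<Rightarrow> real) measure" where
  "euclidean_borel k \<equiv> PiM {..<k} (\<lambda>_. borel)"

definition orthogonal_nat_matrix :: "nat \<Rightarrow> (nat \<Rightarrow> nat \<Rightarrow> real) \<Rightarrow> bool" where
  "orthogonal_nat_matrix k G \<longleftrightarrow>
     (\<forall>i<k. \<forall>j<k. (\<Sum>l<k. G l i * G l j) = (if i = j then 1 else 0)) \<and>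
     (\<forall>i<k. \<forall>j<k. (\<Sum>l<k. G i l * G j l) = (if i = j then 1 else 0))"

definition spherical_distribution :: "nat \<Rightarrow> (nat \<Rightarrow> real) measure \<Rightarrow> bool" where
  "spherical_distribution k \<nu> \<longleftrightarrow>
     prob_space \<nu> \<and> sets \<nu> = sets (euclidean_borel k) \<and>
     (\<forall>G. orthogonal_nat_matrix k G \<longrightarrow>
        distr \<nu> (euclidean_borel k) (\<lambda>z. \<lambda>i\<in>{..<k}. \<Sum>j<k. G i j * z j) = \<nu>)"

definition elliptical_distribution :: "(real^'m) measure \<Rightarrow> bool" where
  "elliptical_distribution \<mu> \<longleftrightarrow>
     (\<exists>k (c :: real^'m) (B :: 'm \<Rightarrow> nat \<Rightarrow> real) \<nu>.
        spherical_distribution k \<nu> \<and>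
        rank ((\<chi> a b. \<Sum>j<k. B a j * B b j) :: real^'m^'m) = k \<and>
        \<mu> = distr \<nu> borel (\<lambda>z. c + (\<chi> a. \<Sum>j<k. B a j * z j)))"

definition order_statistic :: "nat set \<Rightarrow> (nat \<Rightarrow> real) \<Rightarrow> nat \<Rightarrow> ereal" where
  "order_statistic D s k =
     (if k = 0 then -\<infinity>
      else if k \<le> card D then
        ereal (sorted_list_of_multiset (image_mset s (mset_set D)) ! (k - 1))
      else \<infinity>)"

type_synonym ('d, 'm) regression_algorithm =
  "(nat \<Rightarrow> (real^'d) \<times> (real^'m)) \<Rightarrow> real^'d \<Rightarrow> real^'m"

text \<open>
  The functions below act on one realisation of the data. The restriction makes sure that the
  algorithm sees the training data only.
\<close>

definition fitted ::
  "('d, 'm) regression_algorithm \<Rightarrow> nat set \<Rightarrow> (nat \<Rightarrow> real^'d) \<Rightarrow> (nat \<Rightarrow> real^'m) \<Rightarrow>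
   real^'d \<Rightarrow> real^'m" where
  "fitted Alg Dtrain x y = Alg (restrict (\<lambda>t. (x t, y t)) Dtrain)"

definition residual ::
  "('d, 'm) regression_algorithm \<Rightarrow> nat set \<Rightarrow> (nat \<Rightarrow> real^'d) \<Rightarrow> (nat \<Rightarrow> real^'m) \<Rightarrow>
   nat \<Rightarrow> real^'m" where
  "residual Alg Dtrain x y t = y t - fitted Alg Dtrain x y (x t)"

definition hier_conformal_interval ::
  "('d, 'm) regression_algorithm \<Rightarrow> real^'m^'m \<Rightarrow> nat set \<Rightarrow> nat set \<Rightarrow> real \<Rightarrow>
   (nat \<Rightarrow> real^'d) \<Rightarrow> (nat \<Rightarrow> real^'m) \<Rightarrow> real^'d \<Rightarrow> 'm \<Rightarrow> real set" where
  "hier_conformal_interval Alg P Dtrain Dcalib \<alpha> x y xnew i =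
     (let \<mu> = (\<lambda>u. P *v fitted Alg Dtrain x y u);
          s = (\<lambda>t. y t - \<mu> (x t));
          N = real (card Dcalib + 1);
          q = order_statistic Dcalib (\<lambda>t. s t $ i)
      in {u. ereal (\<mu> xnew $ i) + q (nat \<lfloor>N * \<alpha> / 2\<rfloor>) \<le> ereal u \<and>
             ereal u \<le> ereal (\<mu> xnew $ i) + q (nat \<lceil>N * (1 - \<alpha> / 2)\<rceil>)})"

end

theory Submission
  imports Defs
begin

text \<open>
  Both projections fix the coherent observations, so component \<open>i\<close> of the scores is
  \<open>v \<bullet> S t\<close>, where \<open>v\<close> is row \<open>i\<close> of the projection, and the interval length is a gap between two
  order statistics of these scores. For an elliptical law with center \<open>c\<close>, the law of
  \<open>v \<bullet> (S t - c)\<close> depends on \<open>v\<close> only through the variance \<open>v \<bullet> (\<Sigma> *v v)\<close>: a Householder reflection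
  carries one linear form of a spherical vector to any other of the same norm. Hence, jointly over
  the i.i.d. calibration scores, the optimal projection yields in law the centered scores of the
  other one shrunk by the ratio of the standard deviations, which is at most 1 by the orthogonality
  relation behind generalized least squares. The gap scales by the same factor.
\<close>

section \<open>Linear forms of spherical and elliptical vectors\<close>

lemma spherical_distr_linear_form:
  assumes sph: "spherical_distribution k \<nu>"
    and eq: "(\<Sum>j<k. (u j)\<^sup>2) = (\<Sum>j<k. (v j)\<^sup>2)"
  shows "distr \<nu> borel (\<lambda>z. \<Sum>j<k. u j * z j) = distr \<nu> borel (\<lambda>z. \<Sum>j<k. v j * z j)"
proof (cases "\<forall>j<k. u j = v j")
  \<comment> \<open>The reflection below needs \<open>u - v\<close> to be nonzero on the indices
    below \<open>k\<close>, hence the separate case.\<close>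
  case True
  then have "(\<lambda>z. \<Sum>j<k. u j * z j) = (\<lambda>z. \<Sum>j<k. v j * z j)"
    by auto
  then show ?thesis by simp
next
  case False
  define w where "w j = u j - v j" for j
  define n where "n = (\<Sum>j<k. (w j)\<^sup>2)"
  define c where "c = 2 / n"
  \<comment> \<open>Householder reflection \<open>I - c w w^T\<close> along
    \<open>w = u - v\<close>; the value \<open>c = 2 / n\<close> makes it orthogonal.\<close>
  define G where "G i j = (if i = j then 1 else 0) - c * w i * w j" for i j :: nat
  have "n > 0"
    using False unfolding n_def w_def
    by (auto intro!: sum_pos2)
  then have cn: "c * n = 2"
    by (simp add: c_def)
  \<comment> \<open>Equality of the norms enters here: it turns the squared norm of \<open>w\<close>
    into \<open>2 (u, w)\<close>, so that \<open>c (u, w) = 1\<close> and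
    \<open>G u = u - w = v\<close>.\<close>
  have "n = (\<Sum>j<k. (u j)\<^sup>2) + (\<Sum>j<k. (v j)\<^sup>2) - 2 * (\<Sum>j<k. u j * v j)"
    by (simp add: n_def w_def power2_diff sum_subtractf sum.distrib sum_distrib_left algebra_simps)
  also have "\<dots> = 2 * (\<Sum>j<k. u j * w j)"
    using eq by (simp add: w_def sum_subtractf right_diff_distrib power2_eq_square)
  finally have cuw: "c * (\<Sum>j<k. u j * w j) = 1"
    using cn by simp
  have sym: "G i j = G j i" for i j
    by (simp add: G_def)
  have orth: "(\<Sum>l<k. G i l * G j l) = (if i = j then 1 else 0)" if "i < k" "j < k" for i j
  proof -
    have "(\<Sum>l<k. G i l * G j l) =
        (\<Sum>l<k. (if i = l then if j = l then 1 else 0 else 0) - (if i = l then c * w j * w l else 0)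
           - (if j = l then c * w i * w l else 0) + c * c * w i * w j * (w l)\<^sup>2)"
      by (rule sum.cong) (auto simp: G_def algebra_simps power2_eq_square)
    also have "\<dots> = (if i = j then 1 else 0) - 2 * (c * w i * w j) + c * (c * n) * w i * w j"
      using that
      by (simp add: sum.distrib sum_subtractf n_def sum_distrib_left algebra_simps)
    also have "\<dots> = (if i = j then 1 else 0)"
      by (simp add: cn)
    finally show ?thesis .
  qed
  \<comment> \<open>Since \<open>G\<close> is symmetric, orthonormal rows give orthonormal columns
    as well.\<close>
  have "orthogonal_nat_matrix k G"
    unfolding orthogonal_nat_matrix_def
    using orth by (subst (1 2) sym) simp
  then have inv: "distr \<nu> (euclidean_borel k) (\<lambda>z. \<lambda>i\<in>{..<k}. \<Sum>j<k. G i j * z j) = \<nu>"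
    and sets: "sets \<nu> = sets (euclidean_borel k)"
    using sph by (auto simp: spherical_distribution_def)
  \<comment> \<open>Symmetry again: pairing \<open>u\<close> with \<open>G z\<close> amounts to
    pairing \<open>G u = v\<close> with \<open>z\<close>.\<close>
  have image: "(\<Sum>i<k. u i * (\<Sum>j<k. G i j * z j)) = (\<Sum>j<k. v j * z j)" for z
  proof -
    have "(\<Sum>j<k. G i j * z j) = z i - c * w i * (\<Sum>j<k. w j * z j)" if "i < k" for i
    proof -
      have "(\<Sum>j<k. G i j * z j) = (\<Sum>j<k. (if i = j then z j else 0) - c * w i * (w j * z j))"
        by (rule sum.cong) (auto simp: G_def algebra_simps)
      then show ?thesis
        using that by (simp add: sum_subtractf sum_distrib_left)
    qed
    then have "(\<Sum>i<k. u i * (\<Sum>j<k. G i j * z j)) =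
        (\<Sum>i<k. u i * z i - c * (u i * w i) * (\<Sum>j<k. w j * z j))"
      by (intro sum.cong) (simp_all add: right_diff_distrib mult.assoc mult.left_commute)
    also have "\<dots> = (\<Sum>i<k. u i * z i) - c * (\<Sum>i<k. u i * w i) * (\<Sum>j<k. w j * z j)"
      by (simp add: sum_subtractf flip: sum_distrib_right sum_distrib_left)
    also have "\<dots> = (\<Sum>j<k. v j * z j)"
      unfolding cuw by (simp add: w_def left_diff_distrib sum_subtractf)
    finally show ?thesis .
  qed
  have "distr \<nu> borel (\<lambda>z. \<Sum>j<k. u j * z j) =
      distr (distr \<nu> (euclidean_borel k) (\<lambda>z. \<lambda>i\<in>{..<k}. \<Sum>j<k. G i j * z j)) borel
        (\<lambda>z. \<Sum>j<k. u j * z j)"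
    by (simp add: inv)
  also have "\<dots> = distr \<nu> borel (\<lambda>z. \<Sum>j<k. v j * z j)"
    by (subst distr_distr) (auto simp: o_def image measurable_cong_sets[OF sets refl])
  finally show ?thesis .
qed

text \<open>Makes the quadratic form of the covariance matrix a functional of the law of the single
  real variable \<open>u \<bullet> S w\<close>.\<close>

lemma inner_covariance_matrix:
  fixes S :: "'w \<Rightarrow> real^'m"
  assumes "prob_space M" and meas: "S \<in> borel_measurable M"
    and int: "integrable M (\<lambda>w. (norm (S w))\<^sup>2)"
  shows "u \<bullet> (covariance_matrix M S *v u) = (LINT w|M. (u \<bullet> S w - (LINT w|M. u \<bullet> S w))\<^sup>2)"
proof -
  interpret prob_space M by fact
  have comp: "(\<lambda>w. S w $ i) \<in> borel_measurable M" for i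
    using borel_measurable_inner[OF meas borel_measurable_const, of "axis i 1"]
    by (simp add: inner_axis)
  \<comment> \<open>Each product of two components is dominated by the squared norm.\<close>
  have prod: "integrable M (\<lambda>w. S w $ i * S w $ j)" for i j
  proof (rule Bochner_Integration.integrable_bound[OF int])
    have "\<bar>S w $ i\<bar> * \<bar>S w $ j\<bar> \<le> norm (S w) * norm (S w)" for w
      by (intro mult_mono component_le_norm_cart) auto
    then show "AE w in M. norm (S w $ i * S w $ j) \<le> norm ((norm (S w))\<^sup>2)"
      by (simp add: abs_mult power2_eq_square)
  qed (use comp in measurable)
  have lin: "integrable M (\<lambda>w. S w $ i)" for i
    by (rule square_integrable_imp_integrable[OF comp]) (use prod[of i i] in \<open>simp add: power2_eq_square\<close>)
  define m where "m i = (LINT w|M. S w $ i)" for i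
  have mean: "(LINT w|M. u \<bullet> S w) = (\<Sum>i\<in>UNIV. u $ i * m i)"
    by (simp add: inner_vec_def m_def lin)
  have centered: "u \<bullet> S w - (LINT w|M. u \<bullet> S w) = (\<Sum>i\<in>UNIV. u $ i * (S w $ i - m i))" for w
    unfolding mean by (simp add: inner_vec_def right_diff_distrib sum_subtractf)
  have cprod: "integrable M (\<lambda>w. (S w $ i - m i) * (S w $ j - m j))" for i j
  proof -
    have "integrable M (\<lambda>w. S w $ i * S w $ j - m j * S w $ i - m i * S w $ j + m i * m j)"
      using lin prod by simp
    then show ?thesis by (simp add: algebra_simps)
  qed
  have "(LINT w|M. (u \<bullet> S w - (LINT w|M. u \<bullet> S w))\<^sup>2) =
      (LINT w|M. (\<Sum>i\<in>UNIV. \<Sum>j\<in>UNIV. u $ i * u $ j * ((S w $ i - m i) * (S w $ j - m j))))"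
    unfolding centered by (simp add: power2_eq_square sum_product algebra_simps)
  also have "\<dots> = (\<Sum>i\<in>UNIV. \<Sum>j\<in>UNIV. u $ i * u $ j * (LINT w|M. (S w $ i - m i) * (S w $ j - m j)))"
    using cprod by simp
  also have "\<dots> = u \<bullet> (covariance_matrix M S *v u)"
    by (simp add: inner_vec_def matrix_vector_mult_def covariance_matrix_def m_def
        sum_distrib_left algebra_simps)
  finally show ?thesis by simp
qed

text \<open>The law of \<open>u \<bullet> (S w - c)\<close> is determined by \<open>N u\<close>, the
  squared norm of \<open>B^T u\<close>, and in turn determines the variance \<open>Q u\<close>. So
  \<open>N\<close> fixes \<open>Q\<close>; the converse, which is what is wanted, follows because
  both are homogeneous of degree 2. No moment of the spherical vector has to be computed. One center
  \<open>c\<close> serves all \<open>u\<close> and \<open>v\<close>.\<close>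

lemma elliptical_distr_linear_form:
  fixes S :: "'w \<Rightarrow> real^'m"
  assumes M: "prob_space M" and meas[measurable]: "S \<in> borel_measurable M"
    and ell: "elliptical_distribution (distr M borel S)"
    and int: "integrable M (\<lambda>w. (norm (S w))\<^sup>2)"
    and pd: "positive_definite (covariance_matrix M S)"
  obtains c where "\<And>u v. u \<bullet> (covariance_matrix M S *v u) = v \<bullet> (covariance_matrix M S *v v) \<Longrightarrow>
      distr M borel (\<lambda>w. u \<bullet> (S w - c)) = distr M borel (\<lambda>w. v \<bullet> (S w - c))"
proof -
  interpret prob_space M by fact
  define Q where "Q u = u \<bullet> (covariance_matrix M S *v u)" for u
  obtain k c and B :: "'m \<Rightarrow> nat \<Rightarrow> real" and \<nu> where sph: "spherical_distribution k \<nu>"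
    and law: "distr M borel S = distr \<nu> borel (\<lambda>z. c + (\<chi> a. \<Sum>j<k. B a j * z j))"
    using ell unfolding elliptical_distribution_def by blast
  have sets[measurable_cong]: "sets \<nu> = sets (euclidean_borel k)"
    using sph by (simp add: spherical_distribution_def)
  have vec_meas[measurable]: "(\<lambda>z. c + (\<chi> a. \<Sum>j<k. B a j * z j)) \<in> borel_measurable \<nu>"
    by (subst borel_measurable_euclidean_space) (auto simp: Basis_vec_def inner_axis)
  define b where "b u j = (\<Sum>a\<in>UNIV. u $ a * B a j)" for u j
  define N where "N u = (\<Sum>j<k. (b u j)\<^sup>2)" for u
  have N_nonneg: "N u \<ge> 0" for u
    by (simp add: N_def sum_nonneg)
  have form: "distr M borel (\<lambda>w. u \<bullet> (S w - c)) = distr \<nu> borel (\<lambda>z. \<Sum>j<k. b u j * z j)" for u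
  proof -
    have eq: "u \<bullet> (\<chi> a. \<Sum>j<k. B a j * z j) = (\<Sum>j<k. b u j * z j)" for z
      unfolding inner_vec_def b_def
      by (simp add: sum_distrib_left sum_distrib_right mult.assoc) (rule sum.swap)
    have "distr M borel (\<lambda>w. u \<bullet> (S w - c)) = distr (distr M borel S) borel (\<lambda>x. u \<bullet> (x - c))"
      by (subst distr_distr) (auto simp: o_def)
    also have "\<dots> = distr \<nu> borel (\<lambda>z. \<Sum>j<k. b u j * z j)"
      unfolding law by (subst distr_distr) (auto simp: o_def eq)
    finally show ?thesis .
  qed
  have same: "distr M borel (\<lambda>w. u \<bullet> (S w - c)) = distr M borel (\<lambda>w. v \<bullet> (S w - c))"
    if "N u = N v" for u v
    unfolding form using sph that by (intro spherical_distr_linear_form) (simp_all add: N_def)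
  \<comment> \<open>The right-hand side is the variance of the law of the form, so equal laws give
    equal \<open>Q\<close>; the shift by \<open>c\<close> leaves the variance unchanged.\<close>
  have Q_law: "Q u = (LINT x|distr M borel (\<lambda>w. u \<bullet> (S w - c)).
      (x - (LINT x|distr M borel (\<lambda>w. u \<bullet> (S w - c)). x))\<^sup>2)" for u
  proof -
    have "integrable M S"
    proof -
      have "integrable M (\<lambda>w. norm (S w))"
        by (rule square_integrable_imp_integrable[OF _ int]) measurable
      then show ?thesis using meas integrable_norm_iff by blast
    qed
    then have "(LINT w|M. u \<bullet> (S w - c)) = (LINT w|M. u \<bullet> S w) - u \<bullet> c"
      by (simp add: inner_diff_right prob_space)
    then show ?thesis
      unfolding Q_def inner_covariance_matrix[OF M meas int]
      by (simp add: integral_distr inner_diff_right)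
  qed
  have scale: "N (r *\<^sub>R u) = r\<^sup>2 * N u" for r u
    by (simp add: N_def b_def power_mult_distrib sum_distrib_left mult.assoc flip: sum_distrib_left)
  have Q_scale: "Q (r *\<^sub>R u) = r\<^sup>2 * Q u" for r u
    by (simp add: Q_def matrix_vector_mult_scaleR power2_eq_square)
  have N_eq: "N u = N v" if "Q u = Q v" for u v
  proof (cases "Q u = 0")
    case True
    then have "u = 0" "v = 0"
      using pd that unfolding positive_definite_def Q_def by (metis less_irrefl)+
    then show ?thesis by simp
  next
    case False
    \<comment> \<open>Rescaling gives both vectors the value \<open>N u * N v\<close>. Equality of
      \<open>Q\<close> on them reads \<open>N v * Q u = N u * Q v\<close>, and the common nonzero
      value of \<open>Q\<close> cancels.\<close>
    have "N (sqrt (N v) *\<^sub>R u) = N (sqrt (N u) *\<^sub>R v)"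
      by (simp add: scale N_nonneg)
    then have "Q (sqrt (N v) *\<^sub>R u) = Q (sqrt (N u) *\<^sub>R v)"
      by (metis Q_law same)
    then show ?thesis
      using False that by (simp add: Q_scale N_nonneg)
  qed
  show thesis
    by (rule that[of c]) (rule same, rule N_eq, simp add: Q_def)
qed

section \<open>Positive definite matrices, generalized least squares and projections\<close>

lemma matrix_inv_left_right:
  assumes "invertible A"
  shows "matrix_inv A ** A = mat 1" and "A ** matrix_inv A = mat 1"
proof -
  have "A ** matrix_inv A = mat 1 \<and> matrix_inv A ** A = mat 1"
    using assms unfolding invertible_def matrix_inv_def by (rule someI_ex)
  then show "matrix_inv A ** A = mat 1" and "A ** matrix_inv A = mat 1" by auto
qed

lemma positive_definite_invertible:
  fixes A :: "real^'m^'m"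
  assumes "\<And>v. v \<noteq> 0 \<Longrightarrow> v \<bullet> (A *v v) > 0"
  shows "invertible A"
proof -
  have "v = 0" if "A *v v = 0" for v
    using assms[of v] that by auto
  then show ?thesis
    by (simp add: invertible_left_inverse matrix_left_invertible_ker)
qed

text \<open>With \<open>w = matrix_inv \<Sigma> *v v\<close>, the form equals
  \<open>(\<Sigma> *v w) \<bullet> w\<close>, and \<open>w\<close> is nonzero.\<close>

lemma positive_definite_matrix_inv:
  assumes "positive_definite \<Sigma>" and "v \<noteq> 0"
  shows "v \<bullet> (matrix_inv \<Sigma> *v v) > 0"
proof -
  have "\<Sigma> ** matrix_inv \<Sigma> = mat 1"
    using assms(1) positive_definite_invertible matrix_inv_left_right
    unfolding positive_definite_def by blast
  then have v: "\<Sigma> *v (matrix_inv \<Sigma> *v v) = v"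
    by (simp add: matrix_vector_mul_assoc)
  with assms(2) have "matrix_inv \<Sigma> *v v \<noteq> 0" by auto
  then show ?thesis
    using assms(1) v unfolding positive_definite_def by (metis inner_commute)
qed

text \<open>Pythagoras in the inner product given by \<open>\<Sigma>\<close>. The row difference
  \<open>d\<close> annihilates \<open>H\<close>, while \<open>Q ** \<Sigma>\<close> factors through
  \<open>transpose H\<close> on the right; hence \<open>a v* Q\<close> is
  \<open>\<Sigma>\<close>-orthogonal to \<open>d\<close>, and passing from \<open>Q\<close> to
  \<open>P\<close> only adds the nonnegative term
  \<open>d \<bullet> (\<Sigma> *v d)\<close>.\<close>

lemma
  fixes H :: "real^'n^'m"
  assumes pd: "positive_definite \<Sigma>" and inj: "inj ((*v) H)"
  shows weighted_projection_mult: "weighted_projection H (matrix_inv \<Sigma>) ** H = H"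
    and weighted_projection_optimal: "P ** H = H \<Longrightarrow>
      (a v* weighted_projection H (matrix_inv \<Sigma>)) \<bullet> (\<Sigma> *v (a v* weighted_projection H (matrix_inv \<Sigma>)))
        \<le> (a v* P) \<bullet> (\<Sigma> *v (a v* P))"
proof -
  define A where "A = transpose H ** matrix_inv \<Sigma> ** H"
  define Q where "Q = weighted_projection H (matrix_inv \<Sigma>)"
  \<comment> \<open>Injectivity of \<open>H\<close> transfers positive definiteness from
    \<open>matrix_inv \<Sigma>\<close> to \<open>A\<close>, so the inverse in the definition of the
    weighted projection is a genuine one.\<close>
  have "w \<bullet> (A *v w) > 0" if "w \<noteq> 0" for w
  proof -
    have "H *v w \<noteq> 0"
      using that inj by (metis inj_eq matrix_vector_mult_0_right)
    moreover have "w \<bullet> (A *v w) = (H *v w) \<bullet> (matrix_inv \<Sigma> *v (H *v w))"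
      by (metis A_def dot_lmul_matrix matrix_vector_mul_assoc vector_transpose_matrix)
    ultimately show ?thesis
      using positive_definite_matrix_inv[OF pd] by simp
  qed
  then have A_inv: "matrix_inv A ** A = mat 1"
    using positive_definite_invertible matrix_inv_left_right by blast
  have \<Sigma>_inv: "matrix_inv \<Sigma> ** \<Sigma> = mat 1"
    using pd positive_definite_invertible matrix_inv_left_right unfolding positive_definite_def by blast
  have Q_eq: "Q = H ** matrix_inv A ** transpose H ** matrix_inv \<Sigma>"
    by (simp add: Q_def A_def weighted_projection_def)
  have QH: "Q ** H = H"
  proof -
    have "Q ** H = H ** (matrix_inv A ** A)"
      unfolding Q_eq by (simp add: A_def matrix_mul_assoc)
    then show ?thesis by (simp add: A_inv)
  qed
  then show "weighted_projection H (matrix_inv \<Sigma>) ** H = H"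
    by (simp add: Q_def)
  assume PH: "P ** H = H"
  define d where "d = a v* P - a v* Q"
  have "d v* H = 0"
    by (simp add: d_def vector_matrix_mult_diff_distrib vector_matrix_mul_assoc PH QH)
  have sym: "transpose \<Sigma> = \<Sigma>"
    using pd by (simp add: positive_definite_def)
  have Q\<Sigma>: "Q ** \<Sigma> = H ** matrix_inv A ** transpose H"
    unfolding Q_eq by (simp add: matrix_mul_assoc[symmetric] \<Sigma>_inv)
  have "(a v* Q) \<bullet> (\<Sigma> *v d) = a \<bullet> ((Q ** \<Sigma>) *v d)"
    by (simp add: dot_lmul_matrix matrix_vector_mul_assoc)
  also have "\<dots> = 0"
    using \<open>d v* H = 0\<close>
    by (simp add: Q\<Sigma> matrix_vector_mul_assoc[symmetric])
  finally have orth: "(a v* Q) \<bullet> (\<Sigma> *v d) = 0" .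
  have orth': "d \<bullet> (\<Sigma> *v (a v* Q)) = 0"
    using orth sym by (metis dot_lmul_matrix inner_commute transpose_matrix_vector)
  have "d \<bullet> (\<Sigma> *v d) \<ge> 0"
    using pd unfolding positive_definite_def by (cases "d = 0") (auto intro: less_imp_le)
  moreover have "a v* P = a v* Q + d" by (simp add: d_def)
  then have "(a v* P) \<bullet> (\<Sigma> *v (a v* P)) = (a v* Q) \<bullet> (\<Sigma> *v (a v* Q)) + d \<bullet> (\<Sigma> *v d)"
    using orth orth' by (simp add: matrix_vector_right_distrib inner_add_left inner_add_right)
  ultimately show "(a v* weighted_projection H (matrix_inv \<Sigma>)) \<bullet> (\<Sigma> *v (a v* weighted_projection H (matrix_inv \<Sigma>)))
        \<le> (a v* P) \<bullet> (\<Sigma> *v (a v* P))"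
    by (simp add: Q_def)
qed

lemma hierarchy_matrix_inl: "(hierarchy_matrix Hsub *v w) $ Inl j = w $ j"
proof -
  have "hierarchy_matrix Hsub $ Inl j = (mat 1 :: real^'a^'a) $ j"
    by (simp add: hierarchy_matrix_def)
  then have "(hierarchy_matrix Hsub *v w) $ Inl j = (mat 1 *v w) $ j"
    unfolding matrix_vector_mult_def by simp
  then show ?thesis by simp
qed

lemma inj_hierarchy_matrix: "inj ((*v) (hierarchy_matrix Hsub))"
  by (metis (no_types, lifting) hierarchy_matrix_inl injI vec_eq_iff)

text \<open>Every \<open>H *v w\<close> has the form \<open>P *v u\<close>, which the idempotent
  \<open>P\<close> fixes.\<close>

lemma projection_onto_image_mult:
  assumes "projection_onto_image H P"
  shows "P ** H = H"
proof -
  have "(P ** H) *v w = H *v w" for w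
  proof -
    obtain u where "H *v w = P *v u"
      using assms unfolding projection_onto_image_def by blast
    then show ?thesis
      using assms by (metis matrix_vector_mul_assoc projection_onto_image_def)
  qed
  then show ?thesis by (simp add: matrix_eq)
qed

section \<open>Finite order statistics: affine maps and measurability\<close>

text \<open>The finite case of \<open>order_statistic\<close>, split off so that the arguments below
  stay in the reals. Ranks start at 1 and list positions at 0.\<close>

definition sorted_entry :: "nat set \<Rightarrow> (nat \<Rightarrow> real) \<Rightarrow> nat \<Rightarrow> real" where
  "sorted_entry D s k = sorted_list_of_multiset (image_mset s (mset_set D)) ! (k - 1)"

lemma sorted_entry_cong:
  assumes "\<And>t. t \<in> D \<Longrightarrow> s t = s' t"
  shows "sorted_entry D s k = sorted_entry D s' k"
proof (cases "finite D")
  case True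
  then have "image_mset s (mset_set D) = image_mset s' (mset_set D)"
    using assms by (intro image_mset_cong) auto
  then show ?thesis by (simp add: sorted_entry_def)
qed (simp add: sorted_entry_def)

text \<open>A map of nonnegative slope keeps the list sorted, so the image of the sorted list is the
  sorted list of the images. Slope 0 is included.\<close>

lemma sorted_entry_affine:
  assumes "r \<ge> 0" "finite D" "1 \<le> k" "k \<le> card D"
  shows "sorted_entry D (\<lambda>t. a + r * s t) k = a + r * sorted_entry D s k"
proof -
  define xs where "xs = sorted_list_of_multiset (image_mset s (mset_set D))"
  have mset: "mset xs = image_mset s (mset_set D)"
    by (simp add: xs_def)
  have "sorted xs"
    by (simp add: xs_def)
  then have "sorted (map (\<lambda>x. a + r * x) xs)"
    using \<open>r \<ge> 0\<close> by (auto simp: sorted_iff_nth_mono intro: mult_left_mono)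
  moreover have "mset (map (\<lambda>x. a + r * x) xs) = image_mset (\<lambda>t. a + r * s t) (mset_set D)"
    by (simp add: mset multiset.map_comp o_def)
  ultimately have "sorted_list_of_multiset (image_mset (\<lambda>t. a + r * s t) (mset_set D)) =
      map (\<lambda>x. a + r * x) xs"
    by (metis sorted_list_of_multiset_mset sorted_sort_id)
  moreover have "length xs = card D"
    by (metis mset size_image_mset size_mset size_mset_set)
  ultimately show ?thesis
    using assms by (simp add: sorted_entry_def xs_def)
qed

text \<open>In a sorted list the entries at most \<open>c\<close> form an initial segment. Replacing
  the order statistic by a count yields measurability, as the count is a finite sum of
  indicators.\<close>

lemma sorted_entry_le_iff:
  assumes "finite D" "1 \<le> k" "k \<le> card D"
  shows "sorted_entry D s k \<le> c \<longleftrightarrow> k \<le> card {t\<in>D. s t \<le> c}"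
proof -
  define xs where "xs = sorted_list_of_multiset (image_mset s (mset_set D))"
  have mset: "mset xs = image_mset s (mset_set D)"
    by (simp add: xs_def)
  have sorted: "sorted xs"
    by (simp add: xs_def)
  have len: "length xs = card D"
    by (metis mset size_image_mset size_mset size_mset_set)
  have "card {t\<in>D. s t \<le> c} = size (filter_mset (\<lambda>x. x \<le> c) (mset xs))"
    by (simp add: mset filter_mset_image_mset assms(1))
  also have "\<dots> = length (filter (\<lambda>x. x \<le> c) xs)"
    by (metis mset_filter size_mset)
  also have "\<dots> = card {i. i < length xs \<and> xs ! i \<le> c}"
    by (rule length_filter_conv_card)
  finally have card: "card {t\<in>D. s t \<le> c} = card {i. i < length xs \<and> xs ! i \<le> c}" .
  show ?thesis
  proof
    assume le: "sorted_entry D s k \<le> c"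
    have "xs ! i \<le> c" if "i < k" for i
    proof -
      have "xs ! i \<le> xs ! (k - 1)"
        using sorted that assms len by (intro sorted_nth_mono) auto
      then show ?thesis using le by (simp add: sorted_entry_def xs_def)
    qed
    then have "{..<k} \<subseteq> {i. i < length xs \<and> xs ! i \<le> c}"
      using assms len by auto
    then show "k \<le> card {t\<in>D. s t \<le> c}"
      using card_mono[of "{i. i < length xs \<and> xs ! i \<le> c}" "{..<k}"] card by simp
  next
    assume le: "k \<le> card {t\<in>D. s t \<le> c}"
    show "sorted_entry D s k \<le> c"
    proof (rule ccontr)
      assume "\<not> sorted_entry D s k \<le> c"
      then have gt: "xs ! (k - 1) > c"
        by (simp add: sorted_entry_def xs_def)
      have "i < k - 1" if "i < length xs" "xs ! i \<le> c" for i
        using sorted_nth_mono[OF sorted, of "k - 1" i] gt that by force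
      then have "{i. i < length xs \<and> xs ! i \<le> c} \<subseteq> {..<k - 1}"
        by auto
      then show False
        using card_mono[of "{..<k - 1}" "{i. i < length xs \<and> xs ! i \<le> c}"] card le assms by simp
    qed
  qed
qed

lemma measurable_sorted_entry:
  assumes "finite D" "1 \<le> k" "k \<le> card D"
  shows "(\<lambda>s. sorted_entry D s k) \<in> borel_measurable (PiM D (\<lambda>_. borel))"
proof (rule borel_measurableI_le)
  fix c :: real
  have "card {t\<in>D. s t \<le> c} = (\<Sum>t\<in>D. if s t \<le> c then 1 else 0)" for s :: "nat \<Rightarrow> real"
    using assms(1) by (simp add: sum.If_cases Int_def)
  then show "{s \<in> space (PiM D (\<lambda>_. borel)). sorted_entry D s k \<le> c} \<in> sets (PiM D (\<lambda>_. borel))"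
    using assms by (simp add: sorted_entry_le_iff)
qed

section \<open>Lebesgue measure of intervals between order statistics\<close>

lemma emeasure_lborel_eq_top:
  assumes "A \<in> sets borel" and "\<And>n::nat. \<exists>c. {c..c + real n} \<subseteq> A"
  shows "emeasure lborel A = \<infinity>"
proof (rule ccontr)
  assume "emeasure lborel A \<noteq> \<infinity>"
  then obtain n where n: "emeasure lborel A < of_nat n"
    using ennreal_Ex_less_of_nat[of "emeasure lborel A"] by (auto simp: less_top)
  obtain c where "{c..c + real n} \<subseteq> A"
    using assms(2) by blast
  then have "emeasure lborel {c..c + real n} \<le> emeasure lborel A"
    using assms(1) by (intro emeasure_mono) auto
  with n show False
    by (simp add: ennreal_of_nat_eq_real_of_nat)
qed

text \<open>If \<open>k\<close> exceeds \<open>card D\<close> or \<open>l = 0\<close>, an end point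
  is infinite on the wrong side and the set is empty; if otherwise \<open>k = 0\<close> or
  \<open>l\<close> exceeds \<open>card D\<close>, the set contains a half-line. With two finite end
  points in the wrong order, \<open>ennreal\<close> truncates the negative difference to 0, which is
  the measure of the empty set.\<close>

lemma emeasure_order_statistic_interval:
  "emeasure lborel {u. ereal m + order_statistic D s k \<le> ereal u \<and>
       ereal u \<le> ereal m + order_statistic D s l} =
     (if 1 \<le> k \<and> k \<le> card D \<and> 1 \<le> l \<and> l \<le> card D
      then ennreal (sorted_entry D s l - sorted_entry D s k)
      else if k \<le> card D \<and> 1 \<le> l then \<infinity> else 0)"
proof -
  have os: "order_statistic D s j =
      (if j = 0 then -\<infinity> else if j \<le> card D then ereal (sorted_entry D s j) else \<infinity>)" for j
    by (simp add: order_statistic_def sorted_entry_def)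
  define a where "a = sorted_entry D s k"
  define b where "b = sorted_entry D s l"
  have Icc: "{u. m + a \<le> u \<and> u \<le> m + b} = {m + a..m + b}"
    by auto
  have Ici: "emeasure lborel {u. x \<le> u} = \<infinity>" for x :: real
    by (rule emeasure_lborel_eq_top) (auto intro!: exI[of _ x])
  have Iic: "emeasure lborel {u. u \<le> x} = \<infinity>" for x :: real
  proof (rule emeasure_lborel_eq_top)
    show "\<exists>c. {c..c + real n} \<subseteq> {u. u \<le> x}" for n
      by (rule exI[of _ "x - real n"]) auto
  qed auto
  show ?thesis
    unfolding os a_def[symmetric] b_def[symmetric]
    by (auto simp: Icc Ici Iic emeasure_lborel_Icc_eq ennreal_neg)
qed

section \<open>Joint laws of independent scores and comparison of gaps\<close>

text \<open>By independence each joint law is the product of its marginals.\<close>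

lemma (in prob_space) distr_PiM_cong:
  assumes "indep_vars (\<lambda>_. borel) U D" "indep_vars (\<lambda>_. borel) V D" "D \<noteq> {}"
    and "\<And>t. t \<in> D \<Longrightarrow> distr M borel (U t) = distr M borel (V t)"
  shows "distr M (PiM D (\<lambda>_. borel)) (\<lambda>w. \<lambda>t\<in>D. U t w) = distr M (PiM D (\<lambda>_. borel)) (\<lambda>w. \<lambda>t\<in>D. V t w)"
proof -
  have rv: "random_variable borel (U t)" "random_variable borel (V t)" if "t \<in> D" for t
    using assms(1,2) that by (auto simp: indep_vars_def)
  have "distr M (PiM D (\<lambda>_. borel)) (\<lambda>w. \<lambda>t\<in>D. U t w) = (\<Pi>\<^sub>M t\<in>D. distr M borel (U t))"
    using assms rv by (intro iffD1[OF indep_vars_iff_distr_eq_PiM']) auto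
  also have "\<dots> = (\<Pi>\<^sub>M t\<in>D. distr M borel (V t))"
    using assms(4) by (intro PiM_cong) auto
  also have "\<dots> = distr M (PiM D (\<lambda>_. borel)) (\<lambda>w. \<lambda>t\<in>D. V t w)"
    using assms rv by (intro iffD1[OF indep_vars_iff_distr_eq_PiM', symmetric]) auto
  finally show ?thesis .
qed

text \<open>Jointly over \<open>D\<close>, \<open>U\<close> has the law of \<open>r V\<close>, so
  its gap may be replaced under the integral by that of \<open>r V\<close>; the latter is at most
  the gap of \<open>V\<close> at every point.\<close>

lemma (in prob_space) nn_integral_sorted_gap_le:
  assumes U: "indep_vars (\<lambda>_. borel) U D" and V: "indep_vars (\<lambda>_. borel) V D"
    and law: "\<And>t. t \<in> D \<Longrightarrow> distr M borel (U t) = distr M borel (\<lambda>w. r * V t w)"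
    and r: "0 \<le> r" "r \<le> 1"
    and D: "finite D" and k: "1 \<le> k" "k \<le> card D" and l: "1 \<le> l" "l \<le> card D"
  shows "(\<integral>\<^sup>+w. (ennreal (sorted_entry D (\<lambda>t. U t w) l - sorted_entry D (\<lambda>t. U t w) k))\<^sup>2 \<partial>M)
    \<le> (\<integral>\<^sup>+w. (ennreal (sorted_entry D (\<lambda>t. V t w) l - sorted_entry D (\<lambda>t. V t w) k))\<^sup>2 \<partial>M)"
proof -
  define gap where "gap s = (ennreal (sorted_entry D s l - sorted_entry D s k))\<^sup>2" for s
  have gap_meas[measurable]: "gap \<in> borel_measurable (PiM D (\<lambda>_. borel))"
    unfolding gap_def using measurable_sorted_entry[OF D k] measurable_sorted_entry[OF D l]
    by measurable
  have gap_restrict: "gap (\<lambda>t\<in>D. s t) = gap s" for s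
    unfolding gap_def using sorted_entry_cong[of D "restrict s D" s] by simp
  define W where "W = (\<lambda>t w. r * V t w)"
  have W: "indep_vars (\<lambda>_. borel) W D"
    unfolding W_def using V by (rule indep_vars_compose2) simp
  have rv: "(\<lambda>w. \<lambda>t\<in>D. Z t w) \<in> measurable M (PiM D (\<lambda>_. borel))"
    if "indep_vars (\<lambda>_. borel) Z D" for Z :: "nat \<Rightarrow> 'a \<Rightarrow> real"
    using that by (intro measurable_restrict) (auto simp: indep_vars_def)
  have "D \<noteq> {}" using k by auto
  have "(\<integral>\<^sup>+w. gap (\<lambda>t. U t w) \<partial>M) =
      (\<integral>\<^sup>+s. gap s \<partial>distr M (PiM D (\<lambda>_. borel)) (\<lambda>w. \<lambda>t\<in>D. U t w))"
    by (simp add: nn_integral_distr rv[OF U] gap_restrict)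
  also have "\<dots> = (\<integral>\<^sup>+s. gap s \<partial>distr M (PiM D (\<lambda>_. borel)) (\<lambda>w. \<lambda>t\<in>D. W t w))"
    by (subst distr_PiM_cong[OF U W \<open>D \<noteq> {}\<close>]) (simp_all add: W_def law)
  also have "\<dots> = (\<integral>\<^sup>+w. gap (\<lambda>t. W t w) \<partial>M)"
    by (simp add: nn_integral_distr rv[OF W] gap_restrict)
  also have "\<dots> \<le> (\<integral>\<^sup>+w. gap (\<lambda>t. V t w) \<partial>M)"
  proof (rule nn_integral_mono)
    fix w
    \<comment> \<open>For negative \<open>d\<close> both sides are truncated to 0.\<close>
    have "ennreal (r * d) \<le> ennreal d" for d
      using r by (cases "d \<ge> 0") (auto intro: mult_left_le_one_le ennreal_leI simp: ennreal_neg mult_nonneg_nonpos)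
    then show "gap (\<lambda>t. W t w) \<le> gap (\<lambda>t. V t w)"
      using sorted_entry_affine[OF r(1) D k, of 0 "\<lambda>t. V t w"]
        sorted_entry_affine[OF r(1) D l, of 0 "\<lambda>t. V t w"]
      unfolding gap_def W_def
      by (intro power_mono) (simp_all flip: right_diff_distrib)
  qed
  finally show ?thesis by (simp add: gap_def)
qed

section \<open>Length of the conformal interval and the final comparison\<close>

text \<open>Since \<open>P\<close> fixes the observations, the score vector is \<open>P\<close>
  applied to the residual. Recentering at any \<open>c\<close> shifts all scores of component
  \<open>i\<close> by one constant, which cancels in the gap; this freedom lets \<open>c\<close> be
  the elliptical center later.\<close>

lemma emeasure_hier_conformal_interval:
  fixes Alg :: "('d::finite, 'm::finite) regression_algorithm" and P :: "real^'m^'m"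
    and Dtrain Dcalib :: "nat set" and \<alpha> :: real and x :: "nat \<Rightarrow> real^'d" and y :: "nat \<Rightarrow> real^'m"
    and i :: 'm and c :: "real^'m"
  assumes "\<And>t. t \<in> Dcalib \<Longrightarrow> P *v y t = y t" and "finite Dcalib"
  defines "k \<equiv> nat \<lfloor>real (card Dcalib + 1) * \<alpha> / 2\<rfloor>"
    and "l \<equiv> nat \<lceil>real (card Dcalib + 1) * (1 - \<alpha> / 2)\<rceil>"
    and "s \<equiv> \<lambda>t. (axis i 1 v* P) \<bullet> (residual Alg Dtrain x y t - c)"
  shows "emeasure lborel (hier_conformal_interval Alg P Dtrain Dcalib \<alpha> x y xnew i) =
     (if 1 \<le> k \<and> k \<le> card Dcalib \<and> 1 \<le> l \<and> l \<le> card Dcalib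
      then ennreal (sorted_entry Dcalib s l - sorted_entry Dcalib s k)
      else if k \<le> card Dcalib \<and> 1 \<le> l then \<infinity> else 0)"
proof -
  define s' where "s' t = (y t - P *v fitted Alg Dtrain x y (x t)) $ i" for t
  have s': "s' t = (axis i 1 v* P) \<bullet> c + 1 * s t" if "t \<in> Dcalib" for t
  proof -
    have "y t - P *v fitted Alg Dtrain x y (x t) = P *v residual Alg Dtrain x y t"
      using assms(1)[OF that] by (simp add: residual_def matrix_vector_mult_diff_distrib)
    then show ?thesis
      by (simp add: s'_def s_def inner_diff_right dot_lmul_matrix inner_axis')
  qed
  have "sorted_entry Dcalib s' j = (axis i 1 v* P) \<bullet> c + sorted_entry Dcalib s j"
    if "1 \<le> j" "j \<le> card Dcalib" for j
    using sorted_entry_affine[of 1 Dcalib j "(axis i 1 v* P) \<bullet> c" s]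
      sorted_entry_cong[of Dcalib s', OF s'] assms(2) that by simp
  then show ?thesis
    unfolding hier_conformal_interval_def Let_def s'_def[symmetric]
      emeasure_order_statistic_interval k_def[symmetric] l_def[symmetric]
    by auto
qed

theorem theorem4:
  fixes M :: "'w measure"
    and X :: "nat \<Rightarrow> 'w \<Rightarrow> real^'d"
    and Y :: "nat \<Rightarrow> 'w \<Rightarrow> real^('n::finite + 'p::finite)"
    and Hsub :: "real^'n^'p"
    and H :: "real^'n^('n + 'p)"
    and Alg :: "('d, 'n + 'p) regression_algorithm"
    and T :: nat
    and Dtrain Dcalib :: "nat set"
    and \<alpha> :: real
    and S :: "nat \<Rightarrow> 'w \<Rightarrow> real^('n + 'p)"
    and \<Sigma> P :: "real^('n + 'p)^('n + 'p)"
  assumes "prob_space M"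
    and "CARD('n) \<ge> 2"
    and "H = hierarchy_matrix Hsub"
    and "\<And>t. t \<in> {1..T + 1} \<Longrightarrow> X t \<in> borel_measurable M"
    and "\<And>t. t \<in> {1..T + 1} \<Longrightarrow> Y t \<in> borel_measurable M"
    and "\<And>t w. t \<in> {1..T + 1} \<Longrightarrow> w \<in> space M \<Longrightarrow> coherent H (Y t w)"
    and "Dtrain \<union> Dcalib = {1..T}" and "Dtrain \<inter> Dcalib = {}"
    and "0 < \<alpha>" and "\<alpha> < 1"
    and "S = (\<lambda>t w. residual Alg Dtrain (\<lambda>r. X r w) (\<lambda>r. Y r w) t)"
    and "prob_space.indep_vars M (\<lambda>_. borel) S (Dcalib \<union> {T + 1})"
    and "\<And>t t'. t \<in> Dcalib \<union> {T + 1} \<Longrightarrow> t' \<in> Dcalib \<union> {T + 1} \<Longrightarrow>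
           distr M borel (S t) = distr M borel (S t')"
    and "\<And>t. t \<in> Dcalib \<Longrightarrow> elliptical_distribution (distr M borel (S t))"
    and "\<And>t. t \<in> Dcalib \<Longrightarrow> integrable M (\<lambda>w. (norm (S t w))\<^sup>2)"
    and "\<And>t. t \<in> Dcalib \<Longrightarrow> covariance_matrix M (S t) = \<Sigma>"
    and "positive_definite \<Sigma>"
    and "projection_onto_image H P"
  shows "\<forall>i. (\<integral>\<^sup>+w. (emeasure lborel
                (hier_conformal_interval Alg (weighted_projection H (matrix_inv \<Sigma>)) Dtrain Dcalib \<alpha>
                   (\<lambda>t. X t w) (\<lambda>t. Y t w) (X (T + 1) w) i))\<^sup>2 \<partial>M)
          \<le> (\<integral>\<^sup>+w. (emeasure lborel
                (hier_conformal_interval Alg P Dtrain Dcalib \<alpha>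
                   (\<lambda>t. X t w) (\<lambda>t. Y t w) (X (T + 1) w) i))\<^sup>2 \<partial>M)"
proof
  fix i
  interpret prob_space M by fact
  define k where "k = nat \<lfloor>real (card Dcalib + 1) * \<alpha> / 2\<rfloor>"
  define l where "l = nat \<lceil>real (card Dcalib + 1) * (1 - \<alpha> / 2)\<rceil>"
  define P' where "P' = weighted_projection H (matrix_inv \<Sigma>)"
  have D_sub: "Dcalib \<subseteq> {1..T}"
    using assms(7) by blast
  then have D: "finite Dcalib"
    by (rule finite_subset) simp
  have P'H: "P' ** H = H" and PH: "P ** H = H"
    using assms by (simp_all add: P'_def weighted_projection_mult inj_hierarchy_matrix
        projection_onto_image_mult)
  have fix_Y: "Q *v Y t w = Y t w" if "Q ** H = H" "t \<in> Dcalib" "w \<in> space M" for Q t w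
    using assms(6)[of t w] that D_sub unfolding coherent_def
    by (metis Suc_eq_plus1 atLeastAtMost_iff le_SucI matrix_vector_mul_assoc subset_iff)
  define len where "len Q w = emeasure lborel (hier_conformal_interval Alg Q Dtrain Dcalib \<alpha>
    (\<lambda>t. X t w) (\<lambda>t. Y t w) (X (T + 1) w) i)" for Q w
  have len_eq: "len Q w =
      (if 1 \<le> k \<and> k \<le> card Dcalib \<and> 1 \<le> l \<and> l \<le> card Dcalib
       then ennreal (sorted_entry Dcalib (\<lambda>t. (axis i 1 v* Q) \<bullet> (S t w - c)) l
         - sorted_entry Dcalib (\<lambda>t. (axis i 1 v* Q) \<bullet> (S t w - c)) k)
       else if k \<le> card Dcalib \<and> 1 \<le> l then \<infinity> else 0)"
    if "Q ** H = H" "w \<in> space M" for Q c w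
    unfolding len_def k_def l_def assms(11)
    by (rule emeasure_hier_conformal_interval) (use fix_Y that D in auto)
  have "(\<integral>\<^sup>+w. (len P' w)\<^sup>2 \<partial>M) \<le> (\<integral>\<^sup>+w. (len P w)\<^sup>2 \<partial>M)"
  proof (cases "1 \<le> k \<and> k \<le> card Dcalib \<and> 1 \<le> l \<and> l \<le> card Dcalib")
    case False
    \<comment> \<open>The ranks \<open>k\<close> and \<open>l\<close> do not depend on the matrix,
      so here both lengths are the same constant, 0 or infinity. No score appears in it, and the
      center 0 is an arbitrary choice.\<close>
    show ?thesis
      by (rule nn_integral_mono) (simp only: len_eq[of P' _ 0, OF P'H] len_eq[of P _ 0, OF PH]
          False if_False order_refl)
  next
    case True
    then have "Dcalib \<noteq> {}" by auto
    \<comment> \<open>The center comes from one calibration index and is carried to the others by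
      equality of laws, so that a single \<open>c\<close> serves all calibration scores at
      once.\<close>
    then obtain t0 where t0: "t0 \<in> Dcalib" by blast
    have S_meas[measurable]: "S t \<in> borel_measurable M" if "t \<in> Dcalib" for t
      using assms(12) that by (auto simp: indep_vars_def)
    obtain c where c: "\<And>u v. u \<bullet> (\<Sigma> *v u) = v \<bullet> (\<Sigma> *v v) \<Longrightarrow>
        distr M borel (\<lambda>w. u \<bullet> (S t0 w - c)) = distr M borel (\<lambda>w. v \<bullet> (S t0 w - c))"
      using elliptical_distr_linear_form[OF assms(1) S_meas[OF t0] assms(14)[OF t0] assms(15)[OF t0]]
        assms(16)[OF t0] assms(17) by metis
    have law: "distr M borel (\<lambda>w. u \<bullet> (S t w - c)) = distr M borel (\<lambda>w. v \<bullet> (S t w - c))"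
      if "t \<in> Dcalib" "u \<bullet> (\<Sigma> *v u) = v \<bullet> (\<Sigma> *v v)" for t u v
    proof -
      have "distr M borel (\<lambda>w. u \<bullet> (S t w - c)) = distr M borel (\<lambda>w. u \<bullet> (S t0 w - c))" for u
      proof -
        have "distr M borel (\<lambda>w. u \<bullet> (S t w - c)) = distr (distr M borel (S t)) borel (\<lambda>x. u \<bullet> (x - c))"
          using that by (subst distr_distr) (auto simp: o_def)
        also have "\<dots> = distr (distr M borel (S t0)) borel (\<lambda>x. u \<bullet> (x - c))"
          using assms(13)[of t t0] that t0 by simp
        also have "\<dots> = distr M borel (\<lambda>w. u \<bullet> (S t0 w - c))"
          using t0 by (subst distr_distr) (auto simp: o_def)
        finally show ?thesis .
      qed
      then show ?thesis using c[OF that(2)] by simp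
    qed
    define v where "v = axis i 1 v* P"
    define v' where "v' = axis i 1 v* P'"
    define q where "q u = u \<bullet> (\<Sigma> *v u)" for u
    have q_nonneg: "q u \<ge> 0" for u
      using assms(17) unfolding positive_definite_def q_def
      by (cases "u = 0") (auto intro: less_imp_le)
    have q_le: "q v' \<le> q v"
      using weighted_projection_optimal[OF assms(17) _ PH, of "axis i 1"] assms(3)
      by (simp add: q_def v_def v'_def P'_def inj_hierarchy_matrix)
    \<comment> \<open>If \<open>q v = 0\<close>, then \<open>r = 0\<close> because \<open>x / 0 = 0\<close>, and the identity below still holds.\<close>
    define r where "r = sqrt (q v' / q v)"
    have r: "0 \<le> r" "r \<le> 1"
      using q_le q_nonneg[of v] q_nonneg[of v'] by (auto simp: r_def divide_le_eq_1)
    have q_scale: "q (r *\<^sub>R v) = q v'"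
    proof -
      have "q (r *\<^sub>R v) = r\<^sup>2 * q v"
        by (simp add: q_def matrix_vector_mult_scaleR power2_eq_square)
      then show ?thesis
        using q_le q_nonneg[of v] q_nonneg[of v'] by (cases "q v = 0") (simp_all add: r_def)
    qed
    have indep: "indep_vars (\<lambda>_. borel) (\<lambda>t w. u \<bullet> (S t w - c)) Dcalib" for u
    proof -
      have "indep_vars (\<lambda>_. borel) S Dcalib"
        using assms(12) by (rule indep_vars_subset) auto
      then show ?thesis
        by (rule indep_vars_compose2) simp
    qed
    have law_r: "distr M borel (\<lambda>w. v' \<bullet> (S t w - c)) = distr M borel (\<lambda>w. r * (v \<bullet> (S t w - c)))"
      if "t \<in> Dcalib" for t
      using law[OF that, of v' "r *\<^sub>R v"] q_scale by (simp add: q_def)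
    have len_integral: "(\<integral>\<^sup>+w. (len Q w)\<^sup>2 \<partial>M) =
        (\<integral>\<^sup>+w. (ennreal (sorted_entry Dcalib (\<lambda>t. (axis i 1 v* Q) \<bullet> (S t w - c)) l
           - sorted_entry Dcalib (\<lambda>t. (axis i 1 v* Q) \<bullet> (S t w - c)) k))\<^sup>2 \<partial>M)"
      if "Q ** H = H" for Q
      by (rule nn_integral_cong) (simp only: len_eq[of Q _ c, OF that] True if_True simp_thms)
    show ?thesis
      unfolding len_integral[OF P'H] len_integral[OF PH] v_def[symmetric] v'_def[symmetric]
      using indep indep law_r r D by (rule nn_integral_sorted_gap_le) (use True in auto)
  qed
  then show "(\<integral>\<^sup>+w. (emeasure lborel
                (hier_conformal_interval Alg (weighted_projection H (matrix_inv \<Sigma>)) Dtrain Dcalib \<alpha>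
                   (\<lambda>t. X t w) (\<lambda>t. Y t w) (X (T + 1) w) i))\<^sup>2 \<partial>M)
          \<le> (\<integral>\<^sup>+w. (emeasure lborel
                (hier_conformal_interval Alg P Dtrain Dcalib \<alpha>
                   (\<lambda>t. X t w) (\<lambda>t. Y t w) (X (T + 1) w) i))\<^sup>2 \<partial>M)"
    unfolding len_def P'_def .
qed

end
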